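(* Let $B$ be a Banach space, let $\phi_1,\dots,\phi_n\in(B\hat\otimes_\pi B)^*$ be linearly independent and of positive type, and let $\chi=\mathrm{Span}\{\phi_1,\dots,\phi_n\}$. Let $\mathbb X$ be a $B$-valued stochastic process. Then $\mathbb X$ has a $\chi$-quadratic variation if and only if there are continuous processes $Z^1,\dots,Z^n$ such that $[\mathbb X]^\epsilon_t(\phi_i)$ converges in probability to $Z^i_t$ as $\epsilon\to0$, for all $t\in[0,T]$ and $i=1,\dots,n$.
   Context: Fix $T>0$ and a probability space $(\Omega,\mathcal F,\mathbb P)$. Processes on $[0,T]$ are extended by $\mathbb X_t=\mathbb X_0$ for $t\le0$ and $\mathbb X_t=\mathbb X_T$ for $t\ge T$; they are measurable and such that the integrals below make sense. $\mathscr C([0,T])$ is the space of real continuous processes with the topology of uniform convergence in probability (ucp) on $[0,T]$. $B\hat\otimes_\pi B$ is the projective tensor product, whose dual is identified with the bounded bilinear forms on $B\times B$; $x\otimes^2:=x\otimes x$. $\phi\in(B\hat\otimes_\pi B)^*$ is of positive type (positive definite) if $\langle\phi,b\otimes b\rangle\ge0$ for all $b\in B$. For $\phi\in\chi$ set $[\mathbb X]^\epsilon_t(\phi):=\int_0^t\langle\phi,\frac{(\mathbb X_{s+\epsilon}-\mathbb X_s)\otimes^2}{\epsilon}\rangle ds$. For a Banach space $\chi$ continuously included in $(B\hat\otimes_\pi B)^*$ (a Chi-subspace; here $\chi$ is finite dimensional with any norm), elements of $B\hat\otimes_\pi B$ are viewed in $\chi^*$, and $\mathbb X$ has a $\chi$-quadratic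 variation if (H1) every sequence $\epsilon_n\downarrow0$ has a subsequence $(\epsilon_{n_k})$ with $\sup_k\int_0^T\epsilon_{n_k}^{-1}\|(\mathbb X_{s+\epsilon_{n_k}}-\mathbb X_s)\otimes^2\|_{\chi^*}ds<\infty$ a.s.; (H2)(i) there is a map $[\mathbb X]:\chi\to\mathscr C([0,T])$ with $[\mathbb X]^\epsilon(\phi)\to[\mathbb X](\phi)$ ucp as $\epsilon\to0+$ for every $\phi\in\chi$; (H2)(ii) there is a measurable process $\widetilde{[\mathbb X]}:\Omega\times[0,T]\to\chi^*$ with a.s. (càdlàg) bounded variation paths and $\widetilde{[\mathbb X]}(\cdot,t)(\phi)=[\mathbb X](\phi)(\cdot,t)$ a.s. for all $\phi\in\chi$, $t\in[0,T]$. *)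

theory Defs
  imports "HOL-Probability.Probability"
begin

text \<open>
  The dual of the projective tensor product of \<open>B\<close> with itself is identified with the bounded
  bilinear forms on \<open>B \<times> B\<close>, i.e. with the type \<open>'b \<Rightarrow>\<^sub>L 'b \<Rightarrow>\<^sub>L real\<close>; the pairing of \<open>\<phi>\<close> with
  \<open>x \<otimes> y\<close> is \<open>\<phi> x y\<close>.

  A Banach space \<open>\<chi>\<close> continuously included in this dual is represented by a Banach type \<open>'c\<close>
  (carrying the norm of \<open>\<chi>\<close>) together with an injective bounded linear map
  \<open>J :: 'c \<Rightarrow>\<^sub>L ('b \<Rightarrow>\<^sub>L 'b \<Rightarrow>\<^sub>L real)\<close>.  The dual of \<open>\<chi>\<close> is then \<open>'c \<Rightarrow>\<^sub>L real\<close> with its operator norm.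

  Processes are functions of time and outcome, in this order.  Only their values at times in
  \<open>{0..T}\<close> matter.
\<close>

definition positive_type :: "('b::real_normed_vector \<Rightarrow>\<^sub>L 'b \<Rightarrow>\<^sub>L real) \<Rightarrow> bool" where
  "positive_type \<phi> \<longleftrightarrow> (\<forall>b. 0 \<le> \<phi> b b)"

definition measurable_process ::
    "'w measure \<Rightarrow> real \<Rightarrow> (real \<Rightarrow> 'w \<Rightarrow> 'a::topological_space) \<Rightarrow> bool" where
  "measurable_process M T Y \<longleftrightarrow>
     (\<lambda>(\<omega>, t). Y t \<omega>) \<in> borel_measurable (M \<Otimes>\<^sub>M restrict_space borel {0..T})"

definition continuous_process ::
    "'w measure \<Rightarrow> real \<Rightarrow> (real \<Rightarrow> 'w \<Rightarrow> real) \<Rightarrow> bool" where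
  "continuous_process M T Y \<longleftrightarrow>
     measurable_process M T Y \<and> (AE \<omega> in M. continuous_on {0..T} (\<lambda>t. Y t \<omega>))"

text \<open>Extension of a process by its values at \<open>0\<close> and \<open>T\<close>.\<close>

definition extend :: "real \<Rightarrow> (real \<Rightarrow> 'w \<Rightarrow> 'a) \<Rightarrow> real \<Rightarrow> 'w \<Rightarrow> 'a" where
  "extend T X t = X (max 0 (min T t))"

definition increment ::
    "real \<Rightarrow> (real \<Rightarrow> 'w \<Rightarrow> 'b::real_normed_vector) \<Rightarrow> real \<Rightarrow> real \<Rightarrow> 'w \<Rightarrow> 'b" where
  "increment T X \<epsilon> s \<omega> = extend T X (s + \<epsilon>) \<omega> - extend T X s \<omega>"

definition eps_qv ::
    "real \<Rightarrow> (real \<Rightarrow> 'w \<Rightarrow> 'b::real_normed_vector) \<Rightarrow> ('b \<Rightarrow>\<^sub>L 'b \<Rightarrow>\<^sub>L real)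
      \<Rightarrow> real \<Rightarrow> real \<Rightarrow> 'w \<Rightarrow> real" where
  "eps_qv T X \<phi> \<epsilon> t \<omega> =
     (LINT s:{0..t}|lborel. \<phi> (increment T X \<epsilon> s \<omega>) (increment T X \<epsilon> s \<omega>) / \<epsilon>)"

text \<open>
  The requirement that the integrals in \<^const>\<open>eps_qv\<close> make sense.  Measurability of the integrand
  is not implied by that of \<open>X\<close>, since \<open>B\<close> need not be separable.
\<close>

definition eps_qv_well_defined ::
    "'w measure \<Rightarrow> real \<Rightarrow> (real \<Rightarrow> 'w \<Rightarrow> 'b::real_normed_vector)
      \<Rightarrow> ('b \<Rightarrow>\<^sub>L 'b \<Rightarrow>\<^sub>L real) \<Rightarrow> bool" where
  "eps_qv_well_defined M T X \<phi> \<longleftrightarrow>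
     (\<forall>\<epsilon>>0.
        measurable_process M T (\<lambda>s \<omega>. \<phi> (increment T X \<epsilon> s \<omega>) (increment T X \<epsilon> s \<omega>)) \<and>
        (AE \<omega> in M. set_integrable lborel {0..T}
           (\<lambda>s. \<phi> (increment T X \<epsilon> s \<omega>) (increment T X \<epsilon> s \<omega>))))"

definition tendsto_in_prob ::
    "'w measure \<Rightarrow> ('i \<Rightarrow> 'w \<Rightarrow> real) \<Rightarrow> ('w \<Rightarrow> real) \<Rightarrow> 'i filter \<Rightarrow> bool" where
  "tendsto_in_prob M Y Z F \<longleftrightarrow>
     (\<forall>\<delta>>0. ((\<lambda>i. measure M {\<omega> \<in> space M. \<delta> < \<bar>Y i \<omega> - Z \<omega>\<bar>}) \<longlongrightarrow> 0) F)"

text \<open>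
  Uniform convergence in probability on \<open>{0..T}\<close>.  Paths are continuous only almost surely and \<open>M\<close>
  need not be complete, so the event that the supremum exceeds \<open>\<delta>\<close> is measurable only up to a
  subset of a null set; the outer measure takes care of this.
\<close>

definition tendsto_ucp ::
    "'w measure \<Rightarrow> real \<Rightarrow> ('i \<Rightarrow> real \<Rightarrow> 'w \<Rightarrow> real) \<Rightarrow> (real \<Rightarrow> 'w \<Rightarrow> real)
      \<Rightarrow> 'i filter \<Rightarrow> bool" where
  "tendsto_ucp M T Y Z F \<longleftrightarrow>
     (\<forall>\<delta>>0. ((\<lambda>i. outer_measure_of M
                   {\<omega> \<in> space M. \<exists>t\<in>{0..T}. \<delta> < \<bar>Y i t \<omega> - Z t \<omega>\<bar>}) \<longlongrightarrow> 0) F)"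

definition bounded_variation_on :: "real \<Rightarrow> real \<Rightarrow> (real \<Rightarrow> 'a::real_normed_vector) \<Rightarrow> bool" where
  "bounded_variation_on a b f \<longleftrightarrow>
     (\<exists>C. \<forall>(m::nat) (p::nat \<Rightarrow> real).
        mono_on {..m} p \<and> p ` {..m} \<subseteq> {a..b} \<longrightarrow>
        (\<Sum>k<m. norm (f (p (Suc k)) - f (p k))) \<le> C)"

definition cadlag_on :: "real \<Rightarrow> real \<Rightarrow> (real \<Rightarrow> 'a::topological_space) \<Rightarrow> bool" where
  "cadlag_on a b f \<longleftrightarrow>
     (\<forall>t\<in>{a..<b}. (f \<longlongrightarrow> f t) (at_right t)) \<and>
     (\<forall>t\<in>{a<..b}. \<exists>l. (f \<longlongrightarrow> l) (at_left t))"

text \<open>The element \<open>x \<otimes> x\<close> viewed in the dual of \<open>\<chi>\<close>.\<close>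

definition tensor_square ::
    "('c::real_normed_vector \<Rightarrow>\<^sub>L 'b::real_normed_vector \<Rightarrow>\<^sub>L 'b \<Rightarrow>\<^sub>L real) \<Rightarrow> 'b \<Rightarrow> ('c \<Rightarrow>\<^sub>L real)"
  where "tensor_square J x = Blinfun (\<lambda>c. J c x x)"

lemma tensor_square_apply [simp]: "tensor_square J x c = J c x x"
proof -
  have "bounded_linear (\<lambda>c. J c x x)"
    by (intro bounded_linear_intros)
  then show ?thesis
    unfolding tensor_square_def by (simp add: bounded_linear_Blinfun_apply)
qed

definition chi_qv_H1 ::
    "'w measure \<Rightarrow> real \<Rightarrow> ('c::banach \<Rightarrow>\<^sub>L 'b::banach \<Rightarrow>\<^sub>L 'b \<Rightarrow>\<^sub>L real)
      \<Rightarrow> (real \<Rightarrow> 'w \<Rightarrow> 'b) \<Rightarrow> bool" where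
  "chi_qv_H1 M T J X \<longleftrightarrow>
     (\<forall>e::nat \<Rightarrow> real. (\<forall>n. 0 < e n) \<and> decseq e \<and> e \<longlonglongrightarrow> 0 \<longrightarrow>
        (\<exists>r::nat \<Rightarrow> nat. strict_mono r \<and>
           (AE \<omega> in M.
              (SUP k. \<integral>\<^sup>+s\<in>{0..T}.
                 ennreal (norm (tensor_square J (increment T X (e (r k)) s \<omega>)) / e (r k))
                 \<partial>lborel) < \<infinity>)))"

definition chi_qv_H2 ::
    "'w measure \<Rightarrow> real \<Rightarrow> ('c::banach \<Rightarrow>\<^sub>L 'b::banach \<Rightarrow>\<^sub>L 'b \<Rightarrow>\<^sub>L real)
      \<Rightarrow> (real \<Rightarrow> 'w \<Rightarrow> 'b) \<Rightarrow> bool" where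
  "chi_qv_H2 M T J X \<longleftrightarrow>
     (\<exists>Q :: 'c \<Rightarrow> real \<Rightarrow> 'w \<Rightarrow> real.
        (\<forall>c. continuous_process M T (Q c) \<and>
             tendsto_ucp M T (eps_qv T X (J c)) (Q c) (at_right 0)) \<and>
        (\<exists>V :: real \<Rightarrow> 'w \<Rightarrow> ('c \<Rightarrow>\<^sub>L real).
           measurable_process M T V \<and>
           (AE \<omega> in M. cadlag_on 0 T (\<lambda>t. V t \<omega>) \<and> bounded_variation_on 0 T (\<lambda>t. V t \<omega>)) \<and>
           (\<forall>c. \<forall>t\<in>{0..T}. AE \<omega> in M. blinfun_apply (V t \<omega>) c = Q c t \<omega>)))"

definition has_chi_quadratic_variation ::
    "'w measure \<Rightarrow> real \<Rightarrow> ('c::banach \<Rightarrow>\<^sub>L 'b::banach \<Rightarrow>\<^sub>L 'b \<Rightarrow>\<^sub>L real)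
      \<Rightarrow> (real \<Rightarrow> 'w \<Rightarrow> 'b) \<Rightarrow> bool" where
  "has_chi_quadratic_variation M T J X \<longleftrightarrow> chi_qv_H1 M T J X \<and> chi_qv_H2 M T J X"

end

theory Submission
  imports Defs
begin

text \<open>
  The point of positive type is monotonicity: the integrand of the regularised quadratic variation
  \<open>[X]\<^sup>\<epsilon>(\<phi>\<^sub>i)\<close> is nonnegative, so its paths are nondecreasing, and so are those of the limit \<open>Z\<^sub>i\<close>
  (\<open>AE_mono_on_of_tendsto_in_prob\<close>).
  Monotone functions that converge pointwise to a continuous limit converge uniformly; Dini's
  argument works in probability as well, because a fine grid controls all times at once
  (\<open>tendsto_ucp_of_mono\<close>). This upgrades the hypothesis at single times to ucp convergence.

  The rest is linear algebra on the finite-dimensional space \<open>\<chi>\<close>. Coordinates \<open>a\<^sub>i\<close> with respect to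
  \<open>\<phi>\<^sub>1, \<dots>, \<phi>\<^sub>n\<close> are bounded functionals on \<open>\<chi>\<close> whatever its norm
  (\<open>exists_bounded_coordinates\<close>), so \<open>[X](\<phi>) = \<Sum>\<^sub>i a\<^sub>i(\<phi>) Z\<^sub>i\<close> and the
  \<open>\<chi>\<^sup>*\<close>-valued process \<open>\<Sum>\<^sub>i Z\<^sub>i a\<^sub>i\<close> represent the quadratic variation; the latter has bounded variation
  because each \<open>Z\<^sub>i\<close> is nondecreasing. For the boundedness condition, positivity gives
  \<open>\<parallel>x \<otimes> x\<parallel> \<le> \<psi>(x, x)\<close> for the single form \<open>\<psi> = \<Sum>\<^sub>i \<parallel>a\<^sub>i\<parallel> \<phi>\<^sub>i\<close> (\<open>norm_tensor_square_le\<close>), and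
  the regularised quadratic variations of \<open>\<psi>\<close> at time \<open>T\<close> converge in probability, hence almost
  surely, and so boundedly, along a subsequence. Conversely, ucp convergence implies convergence
  at each time.
\<close>

section \<open>Outer measure and convergence in probability\<close>

lemma tendsto_zero_ennrealI:
  fixes f :: "'i \<Rightarrow> ennreal"
  assumes "\<And>\<eta>::real. 0 < \<eta> \<Longrightarrow> \<forall>\<^sub>F i in F. f i \<le> ennreal \<eta>"
  shows "(f \<longlongrightarrow> 0) F"
proof (rule order_tendstoI)
  fix a :: ennreal
  assume "0 < a"
  then obtain b where b: "0 < b" "b < a"
    using dense by blast
  then have "b \<noteq> top"
    using order_less_le_trans[OF b(2) top_greatest] by simp
  then obtain \<eta> where \<eta>: "b = ennreal \<eta>" "0 < \<eta>"
    using b(1) by (cases b) (auto simp: ennreal_less_zero_iff)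
  show "\<forall>\<^sub>F i in F. f i < a"
    using assms[OF \<eta>(2)] by eventually_elim (use b(2) \<eta>(1) in auto)
qed simp

lemma tendsto_zero_ennreal_mono:
  fixes f g :: "'i \<Rightarrow> ennreal"
  assumes le: "\<forall>\<^sub>F i in F. f i \<le> g i" and lim: "(g \<longlongrightarrow> 0) F"
  shows "(f \<longlongrightarrow> 0) F"
proof (rule tendsto_sandwich[OF _ le tendsto_const lim])
  show "\<forall>\<^sub>F i in F. 0 \<le> f i"
    by simp
qed

lemma outer_measure_of_AE_subadditive:
  assumes "finite I" and A: "\<And>i. i \<in> I \<Longrightarrow> A i \<subseteq> space M"
    and S: "S \<subseteq> space M" and cover: "AE \<omega> in M. \<omega> \<in> S \<longrightarrow> (\<exists>i\<in>I. \<omega> \<in> A i)"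
  shows "outer_measure_of M S \<le> (\<Sum>i\<in>I. outer_measure_of M (A i))"
proof -
  from cover obtain N where N: "{\<omega> \<in> space M. \<not> (\<omega> \<in> S \<longrightarrow> (\<exists>i\<in>I. \<omega> \<in> A i))} \<subseteq> N"
      "emeasure M N = 0" "N \<in> sets M"
    by (rule AE_E)
  have "\<forall>i\<in>I. \<exists>E\<in>sets M. A i \<subseteq> E \<and> outer_measure_of M (A i) = emeasure M E"
    using outer_measure_of_attain[OF A] by simp
  then obtain E where E: "\<And>i. i \<in> I \<Longrightarrow> E i \<in> sets M" "\<And>i. i \<in> I \<Longrightarrow> A i \<subseteq> E i"
      "\<And>i. i \<in> I \<Longrightarrow> outer_measure_of M (A i) = emeasure M (E i)"
    by metis
  have U: "(\<Union>i\<in>I. E i) \<in> sets M"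
    using E(1) \<open>finite I\<close> by auto
  have "S \<subseteq> N \<union> (\<Union>i\<in>I. E i)"
    using N(1) E(2) S by fastforce
  then have "outer_measure_of M S \<le> outer_measure_of M (N \<union> (\<Union>i\<in>I. E i))"
    by (rule outer_measure_of_mono)
  also have "\<dots> = emeasure M (N \<union> (\<Union>i\<in>I. E i))"
    using N(3) U by (intro outer_measure_of_eq) auto
  also have "\<dots> \<le> emeasure M N + emeasure M (\<Union>i\<in>I. E i)"
    using N(3) U by (intro emeasure_subadditive)
  also have "\<dots> \<le> (\<Sum>i\<in>I. emeasure M (E i))"
    using E(1) \<open>finite I\<close> N(2) by (auto intro!: emeasure_subadditive_finite)
  also have "\<dots> = (\<Sum>i\<in>I. outer_measure_of M (A i))"
    using E(3) by simp
  finally show ?thesis .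
qed

lemma (in prob_space) tendsto_ucp_imp_tendsto_in_prob:
  assumes ucp: "tendsto_ucp M T Y Z F" and t: "t \<in> {0..T}"
  shows "tendsto_in_prob M (\<lambda>i. Y i t) (Z t) F"
  unfolding tendsto_in_prob_def
proof (intro allI impI)
  fix \<delta> :: real
  assume "0 < \<delta>"
  let ?S = "\<lambda>i. {\<omega> \<in> space M. \<exists>t\<in>{0..T}. \<delta> < \<bar>Y i t \<omega> - Z t \<omega>\<bar>}"
  let ?A = "\<lambda>i. {\<omega> \<in> space M. \<delta> < \<bar>Y i t \<omega> - Z t \<omega>\<bar>}"
  have "emeasure M (?A i) \<le> outer_measure_of M (?S i)" for i
  proof (cases "?A i \<in> sets M")
    case True
    then have "emeasure M (?A i) = outer_measure_of M (?A i)"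
      by simp
    also have "\<dots> \<le> outer_measure_of M (?S i)"
      using t by (intro outer_measure_of_mono) auto
    finally show ?thesis .
  qed (simp add: emeasure_notin_sets)
  moreover have "((\<lambda>i. outer_measure_of M (?S i)) \<longlongrightarrow> 0) F"
    using ucp \<open>0 < \<delta>\<close> by (auto simp: tendsto_ucp_def)
  ultimately have "((\<lambda>i. emeasure M (?A i)) \<longlongrightarrow> 0) F"
    by (rule tendsto_zero_ennreal_mono[OF always_eventually[OF allI]])
  then have "((\<lambda>i. enn2real (emeasure M (?A i))) \<longlongrightarrow> enn2real 0) F"
    by (intro tendsto_enn2real) auto
  then show "((\<lambda>i. measure M (?A i)) \<longlongrightarrow> 0) F"
    by (simp add: measure_def)
qed

text \<open>If the combination is off by more than \<open>\<delta>\<close>, one of its members is off by more than a fixed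
  fraction of \<open>\<delta>\<close>.\<close>

lemma tendsto_ucp_linear_combination:
  fixes a :: "'k \<Rightarrow> real"
  assumes fin: "finite K" and ucp: "\<And>k. k \<in> K \<Longrightarrow> tendsto_ucp M T (Y k) (Z k) F"
    and comb: "\<forall>\<^sub>F i in F. AE \<omega> in M. \<forall>t\<in>{0..T}. W i t \<omega> = (\<Sum>k\<in>K. a k * Y k i t \<omega>)"
  shows "tendsto_ucp M T W (\<lambda>t \<omega>. \<Sum>k\<in>K. a k * Z k t \<omega>) F"
  unfolding tendsto_ucp_def
proof (intro allI impI)
  fix \<delta> :: real
  assume "0 < \<delta>"
  define s where "s = (\<Sum>k\<in>K. \<bar>a k\<bar>) + 1"
  have "0 < s"
    unfolding s_def by (intro add_nonneg_pos sum_nonneg) auto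
  define \<theta> where "\<theta> = \<delta> / s"
  have "0 < \<theta>"
    using \<open>0 < \<delta>\<close> \<open>0 < s\<close> by (simp add: \<theta>_def)
  let ?S = "\<lambda>i. {\<omega> \<in> space M. \<exists>t\<in>{0..T}. \<delta> < \<bar>W i t \<omega> - (\<Sum>k\<in>K. a k * Z k t \<omega>)\<bar>}"
  let ?A = "\<lambda>i k. {\<omega> \<in> space M. \<exists>t\<in>{0..T}. \<theta> < \<bar>Y k i t \<omega> - Z k t \<omega>\<bar>}"
  have "\<forall>\<^sub>F i in F. outer_measure_of M (?S i) \<le> (\<Sum>k\<in>K. outer_measure_of M (?A i k))"
    using comb
  proof eventually_elim
    case (elim i)
    show ?case
    proof (rule outer_measure_of_AE_subadditive[OF fin])
      have "\<exists>k\<in>K. \<omega> \<in> ?A i k"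
        if W: "\<forall>t\<in>{0..T}. W i t \<omega> = (\<Sum>k\<in>K. a k * Y k i t \<omega>)" and S: "\<omega> \<in> ?S i" for \<omega>
      proof (rule ccontr)
        assume nA: "\<not> (\<exists>k\<in>K. \<omega> \<in> ?A i k)"
        from S obtain t where t: "t \<in> {0..T}"
            "\<delta> < \<bar>W i t \<omega> - (\<Sum>k\<in>K. a k * Z k t \<omega>)\<bar>" and \<omega>: "\<omega> \<in> space M"
          by auto
        have close: "\<bar>Y k i t \<omega> - Z k t \<omega>\<bar> \<le> \<theta>" if "k \<in> K" for k
          using nA t(1) \<omega> that by force
        have "W i t \<omega> - (\<Sum>k\<in>K. a k * Z k t \<omega>) = (\<Sum>k\<in>K. a k * (Y k i t \<omega> - Z k t \<omega>))"
          using W t(1) by (simp add: sum_subtractf right_diff_distrib)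
        also have "\<bar>\<dots>\<bar> \<le> (\<Sum>k\<in>K. \<bar>a k * (Y k i t \<omega> - Z k t \<omega>)\<bar>)"
          by (rule sum_abs)
        also have "\<dots> \<le> (\<Sum>k\<in>K. \<bar>a k\<bar> * \<theta>)"
          using close by (intro sum_mono) (auto simp: abs_mult intro: mult_left_mono)
        also have "\<dots> = (s - 1) * \<theta>"
          by (simp add: s_def sum_distrib_right)
        also have "\<dots> \<le> s * \<theta>"
          using \<open>0 < \<theta>\<close> by (intro mult_right_mono) auto
        also have "\<dots> = \<delta>"
          using \<open>0 < s\<close> by (simp add: \<theta>_def)
        finally show False
          using t(2) by simp
      qed
      then show "AE \<omega> in M. \<omega> \<in> ?S i \<longrightarrow> (\<exists>k\<in>K. \<omega> \<in> ?A i k)"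
        using elim by (auto elim: eventually_mono)
    qed auto
  qed
  then show "((\<lambda>i. outer_measure_of M (?S i)) \<longlongrightarrow> 0) F"
  proof (rule tendsto_zero_ennreal_mono)
    show "((\<lambda>i. \<Sum>k\<in>K. outer_measure_of M (?A i k)) \<longlongrightarrow> 0) F"
    proof (rule tendsto_null_sum)
      fix k
      assume "k \<in> K"
      from ucp[OF this] show "((\<lambda>i. outer_measure_of M (?A i k)) \<longlongrightarrow> 0) F"
        unfolding tendsto_ucp_def using \<open>0 < \<theta>\<close> by blast
    qed
  qed
qed

lemma measurable_process_at:
  assumes "measurable_process M T Y" and "t \<in> {0..T}"
  shows "Y t \<in> borel_measurable M"
proof -
  have "(\<lambda>\<omega>. (\<omega>, t)) \<in> M \<rightarrow>\<^sub>M M \<Otimes>\<^sub>M restrict_space borel {0..T}"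
    using assms(2) by (intro measurable_Pair2') (simp add: space_restrict_space)
  from measurable_compose[OF this assms(1)[unfolded measurable_process_def]] show ?thesis
    by simp
qed

text \<open>Truncating at \<open>1\<close> turns convergence in probability into convergence in \<open>L\<^sup>1\<close>, and an
  \<open>L\<^sup>1\<close>-convergent sequence has an almost surely convergent subsequence.\<close>

lemma (in prob_space) tendsto_in_prob_zero_AE_subseq:
  fixes W :: "nat \<Rightarrow> 'a \<Rightarrow> real"
  assumes meas [measurable]: "\<And>n. W n \<in> borel_measurable M"
    and lim: "tendsto_in_prob M W (\<lambda>_. 0) sequentially"
  shows "\<exists>r::nat \<Rightarrow> nat. strict_mono r \<and> (AE \<omega> in M. (\<lambda>n. W (r n) \<omega>) \<longlonglongrightarrow> 0)"
proof -
  define u where "u n \<omega> = min 1 \<bar>W n \<omega>\<bar>" for n \<omega>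
  have [measurable]: "u n \<in> borel_measurable M" for n
    unfolding u_def by measurable
  have int: "integrable M (u n)" for n
    by (rule integrable_const_bound[where B = 1]) (auto simp: u_def)
  have bound: "(\<integral>\<omega>. norm (u n \<omega>) \<partial>M) \<le> \<delta> + prob {\<omega> \<in> space M. \<delta> < \<bar>W n \<omega> - 0\<bar>}"
    if "0 < \<delta>" for n \<delta>
  proof -
    let ?A = "{\<omega> \<in> space M. \<delta> < \<bar>W n \<omega> - 0\<bar>}"
    have [measurable]: "?A \<in> sets M"
      by measurable
    have indA: "integrable M (indicator ?A :: 'a \<Rightarrow> real)"
      by (rule integrable_const_bound[where B = 1]) (auto simp: indicator_def)
    have "(\<integral>\<omega>. norm (u n \<omega>) \<partial>M) \<le> (\<integral>\<omega>. \<delta> + indicator ?A \<omega> \<partial>M)"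
    proof (rule integral_mono)
      show "integrable M (\<lambda>\<omega>. norm (u n \<omega>))"
        using int by (rule integrable_norm)
      show "integrable M (\<lambda>\<omega>. \<delta> + indicator ?A \<omega>)"
        using indA by (intro Bochner_Integration.integrable_add integrable_const)
    qed (use that in \<open>auto simp: u_def indicator_def\<close>)
    also have "\<dots> = \<delta> + prob ?A"
      using indA by (subst Bochner_Integration.integral_add) (auto simp: prob_space)
    finally show ?thesis .
  qed
  have "(\<lambda>n. \<integral>\<omega>. norm (u n \<omega>) \<partial>M) \<longlonglongrightarrow> 0"
  proof (rule LIMSEQ_I)
    fix \<eta> :: real
    assume "0 < \<eta>"
    then have "(\<lambda>n. prob {\<omega> \<in> space M. \<eta> / 2 < \<bar>W n \<omega> - 0\<bar>}) \<longlonglongrightarrow> 0"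
      using lim half_gt_zero unfolding tendsto_in_prob_def by blast
    then have "\<forall>\<^sub>F n in sequentially. prob {\<omega> \<in> space M. \<eta> / 2 < \<bar>W n \<omega> - 0\<bar>} < \<eta> / 2"
      using \<open>0 < \<eta>\<close> by (intro order_tendstoD) auto
    then have "\<forall>\<^sub>F n in sequentially. norm ((\<integral>\<omega>. norm (u n \<omega>) \<partial>M) - 0) < \<eta>"
    proof eventually_elim
      case (elim n)
      have "0 \<le> (\<integral>\<omega>. norm (u n \<omega>) \<partial>M)"
        by (intro Bochner_Integration.integral_nonneg) simp
      then show ?case
        using elim bound[of "\<eta> / 2" n] \<open>0 < \<eta>\<close> by (simp add: field_simps)
    qed
    then show "\<exists>n0. \<forall>n\<ge>n0. norm ((\<integral>\<omega>. norm (u n \<omega>) \<partial>M) - 0) < \<eta>"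
      by (simp add: eventually_sequentially)
  qed
  from tendsto_L1_AE_subseq[of M u, OF int this] obtain r :: "nat \<Rightarrow> nat" where r: "strict_mono r"
      "AE \<omega> in M. (\<lambda>n. u (r n) \<omega>) \<longlonglongrightarrow> 0"
    by auto
  have "AE \<omega> in M. (\<lambda>n. W (r n) \<omega>) \<longlonglongrightarrow> 0"
    using r(2)
  proof eventually_elim
    case (elim \<omega>)
    then have "\<forall>\<^sub>F n in sequentially. u (r n) \<omega> < 1"
      by (intro order_tendstoD) auto
    then have "\<forall>\<^sub>F n in sequentially. u (r n) \<omega> = \<bar>W (r n) \<omega>\<bar>"
      by eventually_elim (auto simp: u_def)
    with elim have "(\<lambda>n. \<bar>W (r n) \<omega>\<bar>) \<longlonglongrightarrow> 0"
      by (rule Lim_transform_eventually)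
    then show ?case
      by (simp add: tendsto_rabs_zero_iff)
  qed
  with r(1) show ?thesis
    by blast
qed

lemma (in prob_space) tendsto_prob_zero_of_AE_eventually:
  assumes meas [measurable]: "\<And>n::nat. G n \<in> sets M"
    and ev: "AE \<omega> in M. \<forall>\<^sub>F n in sequentially. \<omega> \<notin> G n"
  shows "(\<lambda>n. prob (G n)) \<longlonglongrightarrow> 0"
proof -
  have "(\<lambda>n. \<integral>\<omega>. indicator (G n) \<omega> \<partial>M) \<longlonglongrightarrow> (\<integral>\<omega>. (0::real) \<partial>M)"
  proof (rule integral_dominated_convergence[where w = "\<lambda>_. 1"])
    show "AE \<omega> in M. (\<lambda>n. indicator (G n) \<omega> :: real) \<longlonglongrightarrow> 0"
      using ev
    proof eventually_elim
      case (elim \<omega>)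
      then have "\<forall>\<^sub>F n in sequentially. indicator (G n) \<omega> = (0::real)"
        by eventually_elim (auto simp: indicator_def)
      then show ?case
        by (rule tendsto_eventually)
    qed
  qed (auto simp: indicator_def)
  then show ?thesis
    by simp
qed

section \<open>Monotone processes\<close>

lemma mono_on_of_rationals:
  fixes f :: "real \<Rightarrow> real"
  assumes cont: "continuous_on {0..T} f"
    and le: "\<And>p q. p \<in> \<rat> \<inter> {0..T} \<Longrightarrow> q \<in> \<rat> \<inter> {0..T} \<Longrightarrow> p \<le> q \<Longrightarrow> f p \<le> f q"
  shows "mono_on {0..T} f"
proof (rule mono_onI)
  fix s t
  assume st: "s \<in> {0..T}" "t \<in> {0..T}" "s \<le> t"
  \<comment> \<open>Rounding down to multiples of \<open>1/m\<close> stays in \<open>{0..T}\<close> and preserves the order.\<close>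
  define d where "d u m = of_int \<lfloor>u * real (Suc m)\<rfloor> / real (Suc m)" for u :: real and m
  have d_le: "d u m \<le> u" for u m
    unfolding d_def by (simp add: divide_le_eq)
  have d_lim: "d u \<longlonglongrightarrow> u" for u
  proof (rule real_tendsto_sandwich[where f = "\<lambda>m. u - 1 / real (Suc m)" and h = "\<lambda>_. u"])
    show "\<forall>\<^sub>F m in sequentially. u - 1 / real (Suc m) \<le> d u m"
    proof (rule always_eventually, rule allI)
      fix m
      have "u * real (Suc m) - 1 \<le> of_int \<lfloor>u * real (Suc m)\<rfloor>"
        by linarith
      then have "(u * real (Suc m) - 1) / real (Suc m) \<le> d u m"
        unfolding d_def by (rule divide_right_mono) simp
      then show "u - 1 / real (Suc m) \<le> d u m"
        by (simp add: diff_divide_distrib)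
    qed
    have "(\<lambda>m. u - 1 / real (Suc m)) \<longlonglongrightarrow> u - 0"
      by (intro tendsto_diff tendsto_const LIMSEQ_Suc[OF lim_1_over_n])
    then show "(\<lambda>m. u - 1 / real (Suc m)) \<longlonglongrightarrow> u"
      by simp
  qed (auto simp: d_le)
  have d_in: "d u m \<in> \<rat> \<inter> {0..T}" if "u \<in> {0..T}" for u m
  proof -
    have "0 \<le> d u m"
      using that unfolding d_def by simp
    moreover have "d u m \<le> T"
      using d_le[of u m] that by simp
    ultimately show ?thesis
      by (simp add: d_def)
  qed
  have "d s m \<le> d t m" for m
    using st(3) unfolding d_def
    by (intro divide_right_mono) (auto intro!: floor_mono mult_right_mono)
  then have "\<exists>N. \<forall>m\<ge>N. f (d s m) \<le> f (d t m)"
    using le d_in st(1,2) by blast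
  moreover have "(\<lambda>m. f (d u m)) \<longlonglongrightarrow> f u" if "u \<in> {0..T}" for u
    using continuous_on_tendsto_compose[OF cont d_lim that] d_in[OF that] by auto
  ultimately show "f s \<le> f t"
    using LIMSEQ_le st(1,2) by blast
qed

text \<open>If the limits violate the inequality by \<open>2 \<delta>\<close>, one of the approximations is off by more than
  \<open>\<delta>\<close>.\<close>

lemma (in prob_space) AE_le_of_tendsto_in_prob:
  assumes F: "F \<noteq> bot"
    and Y1: "\<forall>\<^sub>F i in F. Y i \<in> borel_measurable M" and Y2: "\<forall>\<^sub>F i in F. Y' i \<in> borel_measurable M"
    and [measurable]: "Z \<in> borel_measurable M" "Z' \<in> borel_measurable M"
    and le: "\<forall>\<^sub>F i in F. AE \<omega> in M. Y i \<omega> \<le> Y' i \<omega>"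
    and lim: "tendsto_in_prob M Y Z F" "tendsto_in_prob M Y' Z' F"
  shows "AE \<omega> in M. Z \<omega> \<le> Z' \<omega>"
proof -
  have small: "AE \<omega> in M. Z \<omega> \<le> Z' \<omega> + 2 * \<delta>" if "0 < \<delta>" for \<delta> :: real
  proof -
    let ?B = "{\<omega> \<in> space M. \<not> (Z \<omega> \<le> Z' \<omega> + 2 * \<delta>)}"
    let ?A = "\<lambda>i. {\<omega> \<in> space M. \<delta> < \<bar>Y i \<omega> - Z \<omega>\<bar>}"
    let ?A' = "\<lambda>i. {\<omega> \<in> space M. \<delta> < \<bar>Y' i \<omega> - Z' \<omega>\<bar>}"
    have B: "?B \<in> sets M"
      by measurable
    have "\<forall>\<^sub>F i in F. prob ?B \<le> prob (?A i) + prob (?A' i)"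
      using Y1 Y2 le
    proof eventually_elim
      case (elim i)
      note [measurable] = elim(1,2)
      have A: "?A i \<in> sets M" "?A' i \<in> sets M"
        by measurable
      have "prob ?B \<le> prob (?A i \<union> ?A' i)"
      proof (rule finite_measure_mono_AE)
        show "AE \<omega> in M. \<omega> \<in> ?B \<longrightarrow> \<omega> \<in> ?A i \<union> ?A' i"
          using elim(3) by eventually_elim auto
      qed (use A in auto)
      also have "\<dots> \<le> prob (?A i) + prob (?A' i)"
        using A by (rule measure_Un_le)
      finally show ?case .
    qed
    moreover have "((\<lambda>i. prob (?A i) + prob (?A' i)) \<longlongrightarrow> 0 + 0) F"
      using lim that by (intro tendsto_add) (auto simp: tendsto_in_prob_def)
    ultimately have "prob ?B \<le> 0"
      using tendsto_lowerbound F by fastforce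
    then have "prob ?B = 0"
      by (simp add: measure_le_0_iff)
    then show ?thesis
      using B prob_eq_0[of ?B] by (auto elim: eventually_mono)
  qed
  have "AE \<omega> in M. \<forall>n. Z \<omega> \<le> Z' \<omega> + 2 * (1 / real (Suc n))"
    unfolding AE_all_countable by (intro allI small) simp
  then show ?thesis
  proof eventually_elim
    case (elim \<omega>)
    have "(\<lambda>n. Z' \<omega> + 2 * (1 / real (Suc n))) \<longlonglongrightarrow> Z' \<omega> + 2 * 0"
      by (intro tendsto_intros LIMSEQ_Suc[OF lim_1_over_n])
    then show ?case
      using elim by (intro LIMSEQ_le_const[where X = "\<lambda>n. Z' \<omega> + 2 * (1 / real (Suc n))"]) auto
  qed
qed

lemma (in prob_space) AE_mono_on_of_tendsto_in_prob:
  fixes Y :: "'i \<Rightarrow> real \<Rightarrow> 'a \<Rightarrow> real"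
  assumes F: "F \<noteq> bot"
    and meas: "\<forall>\<^sub>F i in F. \<forall>t\<in>{0..T}. Y i t \<in> borel_measurable M"
    and mono: "\<forall>\<^sub>F i in F. AE \<omega> in M. mono_on {0..T} (\<lambda>t. Y i t \<omega>)"
    and Z: "continuous_process M T Z"
    and lim: "\<And>t. t \<in> {0..T} \<Longrightarrow> tendsto_in_prob M (\<lambda>i. Y i t) (Z t) F"
  shows "AE \<omega> in M. mono_on {0..T} (\<lambda>t. Z t \<omega>)"
proof -
  have Zm: "Z t \<in> borel_measurable M" if "t \<in> {0..T}" for t
    using Z that measurable_process_at by (auto simp: continuous_process_def)
  have le: "AE \<omega> in M. Z p \<omega> \<le> Z q \<omega>" if pq: "p \<in> {0..T}" "q \<in> {0..T}" "p \<le> q" for p q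
  proof (rule AE_le_of_tendsto_in_prob[OF F _ _ Zm[OF pq(1)] Zm[OF pq(2)] _ lim[OF pq(1)] lim[OF pq(2)]])
    show "\<forall>\<^sub>F i in F. Y i p \<in> borel_measurable M" "\<forall>\<^sub>F i in F. Y i q \<in> borel_measurable M"
      using meas pq by (auto elim: eventually_mono)
    show "\<forall>\<^sub>F i in F. AE \<omega> in M. Y i p \<omega> \<le> Y i q \<omega>"
      using mono
    proof eventually_elim
      case (elim i)
      then show ?case
        by eventually_elim (use pq in \<open>auto intro: mono_onD\<close>)
    qed
  qed
  let ?D = "{(p, q) \<in> (\<rat> \<inter> {0..T}) \<times> (\<rat> \<inter> {0..T}). p \<le> q}"
  have "countable ?D"
    by (rule countable_subset[of _ "\<rat> \<times> \<rat>"]) (auto simp: countable_rat)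
  then have "AE \<omega> in M. \<forall>pq\<in>?D. Z (fst pq) \<omega> \<le> Z (snd pq) \<omega>"
    by (subst AE_ball_countable) (auto intro: le)
  moreover have "AE \<omega> in M. continuous_on {0..T} (\<lambda>t. Z t \<omega>)"
    using Z by (simp add: continuous_process_def)
  ultimately show ?thesis
  proof eventually_elim
    case (elim \<omega>)
    show ?case
      by (rule mono_on_of_rationals[OF elim(2)]) (use elim(1) in force)
  qed
qed

lemma exists_bracketing_index:
  fixes h :: "nat \<Rightarrow> real"
  assumes "h 0 \<le> t" and "t \<le> h (Suc n)"
  shows "\<exists>k\<le>n. h k \<le> t \<and> t \<le> h (Suc k)"
  using assms
proof (induction n)
  case (Suc n)
  show ?case
  proof (cases "t \<le> h (Suc n)")
    case True
    then show ?thesis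
      using Suc by (meson le_SucI)
  next
    case False
    then show ?thesis
      using Suc.prems by (intro exI[of _ "Suc n"]) auto
  qed
qed auto

text \<open>Between two neighbouring grid points both paths are trapped between their grid values, so
  the error there is at most the grid error plus the grid increment of the limit.\<close>

lemma mono_close_of_grid_close:
  fixes f g :: "real \<Rightarrow> real" and h :: "nat \<Rightarrow> real"
  assumes f: "mono_on {0..T} f" and g: "mono_on {0..T} g"
    and h: "h 0 = 0" "h (Suc n) = T" "\<And>k. k \<le> Suc n \<Longrightarrow> h k \<in> {0..T}"
    and incr: "\<And>k. k \<le> n \<Longrightarrow> \<bar>g (h (Suc k)) - g (h k)\<bar> \<le> \<eta>"
    and close: "\<And>k. k \<le> Suc n \<Longrightarrow> \<bar>f (h k) - g (h k)\<bar> \<le> \<eta>"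
    and t: "t \<in> {0..T}"
  shows "\<bar>f t - g t\<bar> \<le> 2 * \<eta>"
proof -
  obtain k where k: "k \<le> n" "h k \<le> t" "t \<le> h (Suc k)"
    using exists_bracketing_index[of h t n] h t by auto
  have hk: "h k \<in> {0..T}" "h (Suc k) \<in> {0..T}"
    using h(3) k(1) by auto
  have "f (h k) \<le> f t" "f t \<le> f (h (Suc k))" "g (h k) \<le> g t" "g t \<le> g (h (Suc k))"
    using mono_onD[OF f] mono_onD[OF g] hk k t by auto
  moreover have "\<bar>g (h (Suc k)) - g (h k)\<bar> \<le> \<eta>" "\<bar>f (h k) - g (h k)\<bar> \<le> \<eta>"
    "\<bar>f (h (Suc k)) - g (h (Suc k))\<bar> \<le> \<eta>"
    using incr close k(1) by auto
  ultimately show ?thesis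
    by linarith
qed

lemma uniform_grid_increments_eventually_small:
  fixes f :: "real \<Rightarrow> real"
  assumes cont: "continuous_on {0..T} f" and T: "0 \<le> T" and \<eta>: "0 < \<eta>"
  shows "\<forall>\<^sub>F N in sequentially. \<forall>k\<le>N.
    \<bar>f (T * real (Suc k) / real (Suc N)) - f (T * real k / real (Suc N))\<bar> \<le> \<eta>"
proof -
  have "uniformly_continuous_on {0..T} f"
    using cont by (intro compact_uniformly_continuous) auto
  then obtain d where d: "0 < d"
      "\<And>s t. s \<in> {0..T} \<Longrightarrow> t \<in> {0..T} \<Longrightarrow> dist t s < d \<Longrightarrow> dist (f t) (f s) < \<eta>"
    using \<eta> unfolding uniformly_continuous_on_def by meson
  have "(\<lambda>N. T * (1 / real (Suc N))) \<longlonglongrightarrow> T * 0"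
    by (intro tendsto_intros LIMSEQ_Suc[OF lim_1_over_n])
  then have "\<forall>\<^sub>F N in sequentially. T * (1 / real (Suc N)) < d"
    using d(1) by (intro order_tendstoD) auto
  then show ?thesis
  proof (eventually_elim, intro allI impI)
    fix N k
    assume N: "T * (1 / real (Suc N)) < d" and k: "k \<le> N"
    let ?s = "T * real k / real (Suc N)" and ?t = "T * real (Suc k) / real (Suc N)"
    have mem: "T * real j / real (Suc N) \<in> {0..T}" if "j \<le> Suc N" for j
    proof -
      have "T * real j \<le> T * real (Suc N)"
        using that T by (intro mult_left_mono) auto
      then show ?thesis
        using T by (auto simp: divide_le_eq)
    qed
    have "?t - ?s = T * (1 / real (Suc N))"
      by (simp add: diff_divide_distrib[symmetric] right_diff_distrib[symmetric])
    then have "dist ?t ?s < d"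
      using N T by (simp add: dist_real_def)
    then have "dist (f ?t) (f ?s) < \<eta>"
      using k by (intro d(2) mem) auto
    then show "\<bar>f ?t - f ?s\<bar> \<le> \<eta>"
      by (simp add: dist_real_def)
  qed
qed

text \<open>Dini's theorem in probability. Along a grid fine enough that the increments of the continuous
  limit exceed \<open>\<delta> / 2\<close> only with small probability, convergence at the finitely many grid points
  controls the whole path by monotonicity.\<close>

lemma (in prob_space) tendsto_ucp_of_mono:
  fixes Y :: "'i \<Rightarrow> real \<Rightarrow> 'a \<Rightarrow> real"
  assumes F: "F \<noteq> bot" and T: "0 \<le> T"
    and meas: "\<forall>\<^sub>F i in F. \<forall>t\<in>{0..T}. Y i t \<in> borel_measurable M"
    and mono: "\<forall>\<^sub>F i in F. AE \<omega> in M. mono_on {0..T} (\<lambda>t. Y i t \<omega>)"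
    and Z: "continuous_process M T Z"
    and lim: "\<And>t. t \<in> {0..T} \<Longrightarrow> tendsto_in_prob M (\<lambda>i. Y i t) (Z t) F"
  shows "tendsto_ucp M T Y Z F"
  unfolding tendsto_ucp_def
proof (intro allI impI)
  fix \<delta> :: real
  assume "0 < \<delta>"
  have Zm: "Z t \<in> borel_measurable M" if "t \<in> {0..T}" for t
    using Z that measurable_process_at by (auto simp: continuous_process_def)
  have Zc: "AE \<omega> in M. continuous_on {0..T} (\<lambda>t. Z t \<omega>)"
    using Z by (simp add: continuous_process_def)
  have Zmono: "AE \<omega> in M. mono_on {0..T} (\<lambda>t. Z t \<omega>)"
    by (rule AE_mono_on_of_tendsto_in_prob[OF F meas mono Z lim])
  define h where "h N k = T * real k / real (Suc N)" for N k
  have h: "h N k \<in> {0..T}" if "k \<le> Suc N" for N k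
  proof -
    have "T * real k \<le> T * real (Suc N)"
      using that T by (intro mult_left_mono) auto
    then show ?thesis
      using T by (auto simp: h_def divide_le_eq)
  qed
  define G where "G N = {\<omega> \<in> space M. \<exists>k\<in>{..N}. \<not> \<bar>Z (h N (Suc k)) \<omega> - Z (h N k) \<omega>\<bar> \<le> \<delta> / 2}"
    for N
  have G: "G N \<in> sets M" for N
    unfolding G_def
  proof (rule sets.sets_Collect_finite_Ex)
    fix k
    assume "k \<in> {..N}"
    then have [measurable]: "Z (h N (Suc k)) \<in> borel_measurable M" "Z (h N k) \<in> borel_measurable M"
      using h by (auto intro!: Zm)
    show "{\<omega> \<in> space M. \<not> \<bar>Z (h N (Suc k)) \<omega> - Z (h N k) \<omega>\<bar> \<le> \<delta> / 2} \<in> sets M"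
      by measurable
  qed simp
  have "AE \<omega> in M. \<forall>\<^sub>F N in sequentially. \<omega> \<notin> G N"
    using Zc
  proof eventually_elim
    case (elim \<omega>)
    have "0 < \<delta> / 2"
      using \<open>0 < \<delta>\<close> by simp
    from uniform_grid_increments_eventually_small[OF elim T this] show ?case
      by eventually_elim (auto simp: G_def h_def)
  qed
  with G have G_lim: "(\<lambda>N. prob (G N)) \<longlonglongrightarrow> 0"
    by (rule tendsto_prob_zero_of_AE_eventually)
  let ?S = "\<lambda>i. {\<omega> \<in> space M. \<exists>t\<in>{0..T}. \<delta> < \<bar>Y i t \<omega> - Z t \<omega>\<bar>}"
  show "((\<lambda>i. outer_measure_of M (?S i)) \<longlongrightarrow> 0) F"
  proof (rule tendsto_zero_ennrealI)
    fix \<eta> :: real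
    assume "0 < \<eta>"
    then have "\<forall>\<^sub>F N in sequentially. prob (G N) < \<eta> / 2"
      using G_lim by (intro order_tendstoD) auto
    then obtain N where N: "prob (G N) < \<eta> / 2"
      by (auto simp: eventually_sequentially)
    let ?A = "\<lambda>i k. {\<omega> \<in> space M. \<delta> / 2 < \<bar>Y i (h N k) \<omega> - Z (h N k) \<omega>\<bar>}"
    have "((\<lambda>i. \<Sum>k\<le>Suc N. prob (?A i k)) \<longlongrightarrow> 0) F"
    proof (rule tendsto_null_sum)
      fix k
      assume "k \<in> {..Suc N}"
      then have "tendsto_in_prob M (\<lambda>i. Y i (h N k)) (Z (h N k)) F"
        using h by (intro lim) simp
      then show "((\<lambda>i. prob (?A i k)) \<longlongrightarrow> 0) F"
        unfolding tendsto_in_prob_def using half_gt_zero[OF \<open>0 < \<delta>\<close>] by blast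
    qed
    then have "\<forall>\<^sub>F i in F. (\<Sum>k\<le>Suc N. prob (?A i k)) < \<eta> / 2"
      using \<open>0 < \<eta>\<close> by (intro order_tendstoD) auto
    then show "\<forall>\<^sub>F i in F. outer_measure_of M (?S i) \<le> ennreal \<eta>"
      using meas mono
    proof eventually_elim
      case (elim i)
      let ?U = "G N \<union> (\<Union>k\<le>Suc N. ?A i k)"
      have A: "?A i k \<in> sets M" if "k \<le> Suc N" for k
      proof -
        have [measurable]: "Y i (h N k) \<in> borel_measurable M" "Z (h N k) \<in> borel_measurable M"
          using h[OF that] elim(2) Zm by auto
        show ?thesis
          by measurable
      qed
      then have UA: "(\<Union>k\<le>Suc N. ?A i k) \<in> sets M"
        by blast
      have cover: "\<omega> \<in> ?U"
        if mono_paths: "mono_on {0..T} (\<lambda>t. Y i t \<omega>)" "mono_on {0..T} (\<lambda>t. Z t \<omega>)"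
          and S: "\<omega> \<in> ?S i" for \<omega>
      proof (rule ccontr)
        assume nU: "\<omega> \<notin> ?U"
        from S obtain t where t: "t \<in> {0..T}" "\<delta> < \<bar>Y i t \<omega> - Z t \<omega>\<bar>" and \<omega>: "\<omega> \<in> space M"
          by auto
        have "\<bar>Y i t \<omega> - Z t \<omega>\<bar> \<le> 2 * (\<delta> / 2)"
        proof (rule mono_close_of_grid_close[OF mono_paths, of "h N" N, OF _ _ h _ _ t(1)])
          show "\<bar>Z (h N (Suc k)) \<omega> - Z (h N k) \<omega>\<bar> \<le> \<delta> / 2" if "k \<le> N" for k
          proof -
            have "\<omega> \<notin> G N"
              using nU by blast
            then show ?thesis
              using \<omega> that by (auto simp: G_def)
          qed
          show "\<bar>Y i (h N k) \<omega> - Z (h N k) \<omega>\<bar> \<le> \<delta> / 2" if "k \<le> Suc N" for k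
          proof -
            have "\<omega> \<notin> ?A i k"
              using nU that by blast
            then show ?thesis
              using \<omega> by simp
          qed
        qed (auto simp: h_def)
        with t(2) show False
          by simp
      qed
      have "AE \<omega> in M. \<omega> \<in> ?S i \<longrightarrow> (\<exists>j\<in>{()}. \<omega> \<in> ?U)"
        using elim(3) Zmono
      proof eventually_elim
        case (elim \<omega>)
        show ?case
          using cover[OF elim] by blast
      qed
      then have "outer_measure_of M (?S i) \<le> (\<Sum>j\<in>{()}. outer_measure_of M ?U)"
        using sets.sets_into_space[OF G]
        by (intro outer_measure_of_AE_subadditive) auto
      also have "\<dots> = ennreal (prob ?U)"
        using G UA by (simp add: emeasure_eq_measure)
      finally have "outer_measure_of M (?S i) \<le> ennreal (prob ?U)" .
      moreover have "prob ?U \<le> prob (G N) + prob (\<Union>k\<le>Suc N. ?A i k)"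
        using G UA by (rule measure_Un_le)
      moreover have "prob (\<Union>k\<le>Suc N. ?A i k) \<le> (\<Sum>k\<le>Suc N. prob (?A i k))"
        using A by (intro measure_UNION_le) auto
      ultimately show ?case
        using N elim(1) by (elim order_trans, intro ennreal_leI) linarith
    qed
  qed
qed

section \<open>Bounded coordinates on a finite-dimensional space of forms\<close>

text \<open>Gram--Schmidt with functionals in place of an inner product: whenever functionals separate
  points, each new basis vector, corrected by its components along the old ones, is detected by some
  functional, which can then be normalised and used to correct the old functionals.\<close>

lemma exists_dual_functionals:
  fixes S :: "'a::real_normed_vector set"
  assumes "finite S" and "independent S"
    and sep: "\<And>x::'a. x \<noteq> 0 \<Longrightarrow> \<exists>f :: 'a \<Rightarrow>\<^sub>L real. f x \<noteq> 0"
  shows "\<exists>a :: 'a \<Rightarrow> 'a \<Rightarrow>\<^sub>L real. \<forall>s\<in>S. \<forall>u\<in>S. a s u = (if s = u then 1 else 0)"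
  using assms(1,2)
proof (induction S rule: finite_induct)
  case (insert v S)
  then have indep: "independent S" and v: "v \<notin> span S"
    using independent_insert[of v S] by auto
  obtain a :: "'a \<Rightarrow> 'a \<Rightarrow>\<^sub>L real"
    where a: "\<And>s u. s \<in> S \<Longrightarrow> u \<in> S \<Longrightarrow> a s u = (if s = u then 1 else 0)"
    using insert.IH[OF indep] by blast
  define w where "w = v - (\<Sum>s\<in>S. a s v *\<^sub>R s)"
  have "w \<noteq> 0"
  proof
    assume "w = 0"
    then have "v = (\<Sum>s\<in>S. a s v *\<^sub>R s)"
      by (simp add: w_def)
    also have "\<dots> \<in> span S"
      by (intro span_sum span_scale span_base)
    finally show False
      using v by blast
  qed
  then obtain f :: "'a \<Rightarrow>\<^sub>L real" where f: "f w \<noteq> 0"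
    using sep by blast
  define b where "b = (1 / f w) *\<^sub>R (f - (\<Sum>s\<in>S. f s *\<^sub>R a s))"
  have b_S: "b u = 0" if "u \<in> S" for u
  proof -
    have "(\<Sum>s\<in>S. f s * a s u) = (\<Sum>s\<in>S. f s * (if s = u then 1 else 0))"
      using a that by (intro sum.cong) auto
    also have "\<dots> = f u"
      using that insert.hyps(1) by (simp add: if_distrib cong: if_cong)
    finally show ?thesis
      by (simp add: b_def blinfun.diff_left blinfun.sum_left blinfun.scaleR_left)
  qed
  have "f w = f v - (\<Sum>s\<in>S. f s * a s v)"
    by (simp add: w_def blinfun.diff_right blinfun.sum_right blinfun.scaleR_right mult.commute)
  then have b_v: "b v = 1"
    using f by (simp add: b_def blinfun.diff_left blinfun.sum_left blinfun.scaleR_left)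
  define a' where "a' s = (if s = v then b else a s - a s v *\<^sub>R b)" for s
  have "a' s u = (if s = u then 1 else 0)" if "s \<in> insert v S" "u \<in> insert v S" for s u
    using that a b_S b_v insert.hyps(2)
    by (auto simp: a'_def blinfun.diff_left blinfun.scaleR_left)
  then show ?case
    by blast
qed simp

text \<open>The functionals \<open>c \<mapsto> J c u v\<close> separate the points of the domain of \<open>J\<close>, so the norm there
  needs no comparison with a Euclidean one.\<close>

lemma exists_bounded_coordinates:
  fixes J :: "'c::real_normed_vector \<Rightarrow>\<^sub>L 'b::real_normed_vector \<Rightarrow>\<^sub>L 'b \<Rightarrow>\<^sub>L real"
    and \<phi> :: "'i \<Rightarrow> 'b \<Rightarrow>\<^sub>L 'b \<Rightarrow>\<^sub>L real"
  assumes fin: "finite I" and inj_\<phi>: "inj_on \<phi> I" and indep: "independent (\<phi> ` I)"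
    and inj_J: "inj (blinfun_apply J)" and range_J: "range (blinfun_apply J) = span (\<phi> ` I)"
  shows "\<exists>a :: 'i \<Rightarrow> 'c \<Rightarrow>\<^sub>L real. \<forall>c. J c = (\<Sum>i\<in>I. a i c *\<^sub>R \<phi> i)"
proof -
  define c where "c i = inv (blinfun_apply J) (\<phi> i)" for i
  have Jc: "J (c i) = \<phi> i" if "i \<in> I" for i
    unfolding c_def using that range_J span_base[of "\<phi> i" "\<phi> ` I"] by (intro f_inv_into_f) auto
  have inj_c: "inj_on c I"
    using inj_\<phi> Jc by (metis inj_on_def)
  have indep_c: "independent (c ` I)"
  proof
    assume "dependent (c ` I)"
    then obtain u i where u: "i \<in> I" "u (c i) \<noteq> 0" "(\<Sum>i\<in>I. u (c i) *\<^sub>R c i) = 0"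
      using fin inj_c by (auto simp: dependent_finite sum.reindex)
    have "(\<Sum>v\<in>\<phi> ` I. u (c (the_inv_into I \<phi> v)) *\<^sub>R v) = (\<Sum>i\<in>I. u (c i) *\<^sub>R \<phi> i)"
      using inj_\<phi> by (simp add: sum.reindex the_inv_into_f_f)
    also have "\<dots> = J (\<Sum>i\<in>I. u (c i) *\<^sub>R c i)"
      using Jc by (simp add: blinfun.sum_right blinfun.scaleR_right)
    also have "\<dots> = 0"
      using u(3) by (simp add: blinfun.zero_right)
    finally have "u (c (the_inv_into I \<phi> (\<phi> i))) = 0"
      using independentD[OF indep finite_imageI[OF fin] subset_refl] u(1) by fast
    with u(1,2) inj_\<phi> show False
      by (simp add: the_inv_into_f_f)
  qed
  have sep: "\<exists>f :: 'c \<Rightarrow>\<^sub>L real. f x \<noteq> 0" if "x \<noteq> 0" for x :: 'c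
  proof -
    have "J x \<noteq> 0"
      using that inj_J by (metis blinfun.zero_right injD)
    then obtain u v where uv: "J x u v \<noteq> 0"
      by (metis blinfun_eqI blinfun.zero_left)
    have "bounded_linear (\<lambda>y. J y u v)"
      by (intro bounded_linear_intros)
    then have "blinfun_apply (Blinfun (\<lambda>y. J y u v)) x \<noteq> 0"
      using uv by (simp add: bounded_linear_Blinfun_apply)
    then show ?thesis
      by blast
  qed
  obtain a :: "'c \<Rightarrow> 'c \<Rightarrow>\<^sub>L real"
    where a: "\<And>s u. s \<in> c ` I \<Longrightarrow> u \<in> c ` I \<Longrightarrow> a s u = (if s = u then 1 else 0)"
    using exists_dual_functionals[OF finite_imageI[OF fin] indep_c sep] by blast
  have "J x = (\<Sum>i\<in>I. a (c i) x *\<^sub>R \<phi> i)" for x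
  proof -
    have "J x \<in> span (\<phi> ` I)"
      using range_J by blast
    then obtain u where "J x = (\<Sum>v\<in>\<phi> ` I. u v *\<^sub>R v)"
      using fin by (auto simp: span_finite)
    then obtain r where r: "J x = (\<Sum>i\<in>I. r i *\<^sub>R \<phi> i)"
      using inj_\<phi> by (auto simp: sum.reindex)
    also have "(\<Sum>i\<in>I. r i *\<^sub>R \<phi> i) = J (\<Sum>i\<in>I. r i *\<^sub>R c i)"
      using Jc by (simp add: blinfun.sum_right blinfun.scaleR_right)
    finally have x: "x = (\<Sum>i\<in>I. r i *\<^sub>R c i)"
      using inj_J by (auto dest: injD)
    have "a (c i) x = r i" if "i \<in> I" for i
    proof -
      have "a (c i) x = (\<Sum>j\<in>I. r j * (if i = j then 1 else 0))"
        unfolding x blinfun.sum_right blinfun.scaleR_right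
        using a that inj_c by (intro sum.cong) (auto simp: inj_on_eq_iff)
      then show ?thesis
        using that fin by (simp add: if_distrib cong: if_cong)
    qed
    with r show ?thesis
      by simp
  qed
  then show ?thesis
    by (intro exI[of _ "\<lambda>i. a (c i)"] allI)
qed

section \<open>Regularised quadratic variations\<close>

text \<open>The integrand is a process on \<open>{0..T}\<close> only; evaluating it at the clamped time gives a
  function measurable on the whole time axis, so Fubini's measurability statement applies.\<close>

lemma eps_qv_measurable:
  assumes wd: "eps_qv_well_defined M T X \<psi>" and \<epsilon>: "0 < \<epsilon>" and t: "t \<in> {0..T}"
  shows "eps_qv T X \<psi> \<epsilon> t \<in> borel_measurable M"
proof -
  define f where "f s \<omega> = \<psi> (increment T X \<epsilon> s \<omega>) (increment T X \<epsilon> s \<omega>)" for s \<omega>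
  have f: "(\<lambda>(\<omega>, s). f s \<omega>) \<in> borel_measurable (M \<Otimes>\<^sub>M restrict_space borel {0..T})"
    using wd \<epsilon> by (auto simp: eps_qv_well_defined_def measurable_process_def f_def)
  have clamp: "(\<lambda>x. (fst x, max 0 (min T (snd x)))) \<in> M \<Otimes>\<^sub>M lborel \<rightarrow>\<^sub>M M \<Otimes>\<^sub>M restrict_space borel {0..T}"
  proof (rule measurable_Pair)
    show "(\<lambda>x. max 0 (min T (snd x))) \<in> M \<Otimes>\<^sub>M lborel \<rightarrow>\<^sub>M restrict_space borel {0..T}"
      using t by (intro measurable_restrict_space2) auto
  qed simp
  have [measurable]: "(\<lambda>x. f (max 0 (min T (snd x))) (fst x)) \<in> borel_measurable (M \<Otimes>\<^sub>M lborel)"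
    using measurable_compose[OF clamp f] by simp
  have "(\<lambda>(\<omega>, s). indicator {0..t} s *\<^sub>R (f (max 0 (min T s)) \<omega> / \<epsilon>))
      \<in> borel_measurable (M \<Otimes>\<^sub>M lborel)"
    unfolding case_prod_beta by measurable
  then have "(\<lambda>\<omega>. LINT s|lborel. indicator {0..t} s *\<^sub>R (f (max 0 (min T s)) \<omega> / \<epsilon>)) \<in> borel_measurable M"
    by (rule lborel.borel_measurable_lebesgue_integral)
  also have "(\<lambda>\<omega>. LINT s|lborel. indicator {0..t} s *\<^sub>R (f (max 0 (min T s)) \<omega> / \<epsilon>)) = eps_qv T X \<psi> \<epsilon> t"
    unfolding eps_qv_def set_lebesgue_integral_def f_def[symmetric]
    using t by (intro ext Bochner_Integration.integral_cong) (auto simp: indicator_def)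
  finally show ?thesis .
qed

lemma eps_qv_AE_set_integrable:
  assumes "eps_qv_well_defined M T X \<psi>" and "0 < \<epsilon>"
  shows "AE \<omega> in M. \<forall>t\<in>{0..T}. set_integrable lborel {0..t}
           (\<lambda>s. \<psi> (increment T X \<epsilon> s \<omega>) (increment T X \<epsilon> s \<omega>) / \<epsilon>)"
proof -
  have "AE \<omega> in M. set_integrable lborel {0..T}
           (\<lambda>s. \<psi> (increment T X \<epsilon> s \<omega>) (increment T X \<epsilon> s \<omega>))"
    using assms by (auto simp: eps_qv_well_defined_def)
  then show ?thesis
  proof eventually_elim
    case (elim \<omega>)
    show ?case
    proof
      fix t
      assume "t \<in> {0..T}"
      then have "set_integrable lborel {0..t} (\<lambda>s. \<psi> (increment T X \<epsilon> s \<omega>) (increment T X \<epsilon> s \<omega>))"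
        by (intro set_integrable_subset[OF elim]) auto
      then show "set_integrable lborel {0..t}
           (\<lambda>s. \<psi> (increment T X \<epsilon> s \<omega>) (increment T X \<epsilon> s \<omega>) / \<epsilon>)"
        using assms(2) by simp
    qed
  qed
qed

lemma eps_qv_AE_mono:
  assumes wd: "eps_qv_well_defined M T X \<psi>" and pos: "positive_type \<psi>" and \<epsilon>: "0 < \<epsilon>"
  shows "AE \<omega> in M. mono_on {0..T} (\<lambda>t. eps_qv T X \<psi> \<epsilon> t \<omega>)"
  using eps_qv_AE_set_integrable[OF wd \<epsilon>]
proof eventually_elim
  case (elim \<omega>)
  show ?case
  proof (rule mono_onI)
    fix s t
    assume "s \<in> {0..T}" "t \<in> {0..T}" "s \<le> t"
    then show "eps_qv T X \<psi> \<epsilon> s \<omega> \<le> eps_qv T X \<psi> \<epsilon> t \<omega>"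
      using elim pos \<epsilon> unfolding eps_qv_def set_lebesgue_integral_def set_integrable_def
      by (intro integral_mono) (auto simp: indicator_def positive_type_def)
  qed
qed

lemma eps_qv_AE_linear_combination:
  assumes fin: "finite I" and wd: "\<And>i. i \<in> I \<Longrightarrow> eps_qv_well_defined M T X (\<phi> i)" and \<epsilon>: "0 < \<epsilon>"
  shows "AE \<omega> in M. \<forall>t\<in>{0..T}.
    eps_qv T X (\<Sum>i\<in>I. r i *\<^sub>R \<phi> i) \<epsilon> t \<omega> = (\<Sum>i\<in>I. r i * eps_qv T X (\<phi> i) \<epsilon> t \<omega>)"
proof -
  have "AE \<omega> in M. \<forall>i\<in>I. \<forall>t\<in>{0..T}. set_integrable lborel {0..t}
           (\<lambda>s. \<phi> i (increment T X \<epsilon> s \<omega>) (increment T X \<epsilon> s \<omega>) / \<epsilon>)"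
    by (intro AE_finite_allI fin eps_qv_AE_set_integrable wd \<epsilon>)
  then show ?thesis
  proof eventually_elim
    case (elim \<omega>)
    show ?case
    proof
      fix t
      assume t: "t \<in> {0..T}"
      let ?q = "\<lambda>i s. \<phi> i (increment T X \<epsilon> s \<omega>) (increment T X \<epsilon> s \<omega>) / \<epsilon>"
      have int: "integrable lborel (\<lambda>s. indicator {0..t} s *\<^sub>R ?q i s)" if "i \<in> I" for i
        using elim that t by (auto simp: set_integrable_def)
      have "eps_qv T X (\<Sum>i\<in>I. r i *\<^sub>R \<phi> i) \<epsilon> t \<omega>
          = (LINT s|lborel. (\<Sum>i\<in>I. r i * (indicator {0..t} s *\<^sub>R ?q i s)))"
        unfolding eps_qv_def set_lebesgue_integral_def
        by (intro Bochner_Integration.integral_cong)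
          (auto simp: blinfun.sum_left blinfun.scaleR_left sum_divide_distrib sum_distrib_left
            intro!: sum.cong)
      also have "\<dots> = (\<Sum>i\<in>I. r i * (LINT s|lborel. indicator {0..t} s *\<^sub>R ?q i s))"
      proof (subst Bochner_Integration.integral_sum)
        show "integrable lborel (\<lambda>s. r i * (indicator {0..t} s *\<^sub>R ?q i s))" if "i \<in> I" for i
          using int[OF that] by (intro Bochner_Integration.integrable_mult_right)
      qed simp
      finally show "eps_qv T X (\<Sum>i\<in>I. r i *\<^sub>R \<phi> i) \<epsilon> t \<omega> = (\<Sum>i\<in>I. r i * eps_qv T X (\<phi> i) \<epsilon> t \<omega>)"
        by (simp add: eps_qv_def set_lebesgue_integral_def)
    qed
  qed
qed

text \<open>Bounding each coordinate \<open>a\<^sub>i(c)\<close> by \<open>\<parallel>a\<^sub>i\<parallel> \<parallel>c\<parallel>\<close> leaves a quantity that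
  is again the value at \<open>(x, x)\<close> of a form, because the \<open>\<phi>\<^sub>i(x, x)\<close> are nonnegative and no absolute
  values remain.\<close>

lemma norm_tensor_square_le:
  fixes J :: "'c::real_normed_vector \<Rightarrow>\<^sub>L 'b::real_normed_vector \<Rightarrow>\<^sub>L 'b \<Rightarrow>\<^sub>L real"
    and a :: "'i \<Rightarrow> 'c \<Rightarrow>\<^sub>L real"
  assumes J: "\<And>c. J c = (\<Sum>i\<in>I. a i c *\<^sub>R \<phi> i)" and pos: "\<And>i. i \<in> I \<Longrightarrow> positive_type (\<phi> i)"
  shows "norm (tensor_square J x) \<le> (\<Sum>i\<in>I. norm (a i) *\<^sub>R \<phi> i) x x"
proof (rule norm_blinfun_bound)
  have nonneg: "0 \<le> \<phi> i x x" if "i \<in> I" for i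
    using pos[OF that] by (simp add: positive_type_def)
  have eq: "(\<Sum>i\<in>I. norm (a i) *\<^sub>R \<phi> i) x x = (\<Sum>i\<in>I. norm (a i) * \<phi> i x x)"
    by (simp add: blinfun.sum_left blinfun.scaleR_left)
  show "0 \<le> (\<Sum>i\<in>I. norm (a i) *\<^sub>R \<phi> i) x x"
    unfolding eq using nonneg by (intro sum_nonneg mult_nonneg_nonneg) auto
  fix c
  have "norm (tensor_square J x c) = \<bar>\<Sum>i\<in>I. a i c * \<phi> i x x\<bar>"
    by (simp add: J blinfun.sum_left blinfun.scaleR_left)
  also have "\<dots> \<le> (\<Sum>i\<in>I. \<bar>a i c * \<phi> i x x\<bar>)"
    by (rule sum_abs)
  also have "\<dots> \<le> (\<Sum>i\<in>I. norm (a i) * norm c * \<phi> i x x)"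
  proof (rule sum_mono)
    fix i
    assume "i \<in> I"
    moreover have "\<bar>a i c\<bar> \<le> norm (a i) * norm c"
      using norm_blinfun[of "a i" c] by simp
    ultimately show "\<bar>a i c * \<phi> i x x\<bar> \<le> norm (a i) * norm c * \<phi> i x x"
      using nonneg by (simp add: abs_mult mult_right_mono)
  qed
  also have "\<dots> = (\<Sum>i\<in>I. norm (a i) *\<^sub>R \<phi> i) x x * norm c"
    unfolding eq sum_distrib_right by (intro sum.cong) (auto simp: mult_ac)
  finally show "norm (tensor_square J x c) \<le> (\<Sum>i\<in>I. norm (a i) *\<^sub>R \<phi> i) x x * norm c" .
qed

text \<open>Since one form dominates \<open>\<parallel>x \<otimes> x\<parallel>\<close>, a subsequence along which its regularised quadratic
  variation at the final time converges almost surely is the one required.\<close>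

lemma (in prob_space) chi_qv_H1_of_dominating_form:
  fixes X :: "real \<Rightarrow> 'a \<Rightarrow> 'b::banach"
    and J :: "'c::banach \<Rightarrow>\<^sub>L 'b \<Rightarrow>\<^sub>L 'b \<Rightarrow>\<^sub>L real"
    and \<psi> :: "'b \<Rightarrow>\<^sub>L 'b \<Rightarrow>\<^sub>L real"
  assumes T: "0 \<le> T" and dom: "\<And>x. norm (tensor_square J x) \<le> \<psi> x x"
    and wd: "eps_qv_well_defined M T X \<psi>" and Z [measurable]: "Z \<in> borel_measurable M"
    and lim: "tendsto_in_prob M (\<lambda>\<epsilon>. eps_qv T X \<psi> \<epsilon> T) Z (at_right 0)"
  shows "chi_qv_H1 M T J X"
  unfolding chi_qv_H1_def
proof (intro allI impI, elim conjE)
  fix e :: "nat \<Rightarrow> real"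
  assume pos: "\<forall>n. 0 < e n" and "e \<longlonglongrightarrow> 0"
  then have e: "filterlim e (at_right 0) sequentially"
    by (intro tendsto_imp_filterlim_at_right) auto
  let ?W = "\<lambda>n \<omega>. eps_qv T X \<psi> (e n) T \<omega> - Z \<omega>"
  have [measurable]: "eps_qv T X \<psi> (e n) T \<in> borel_measurable M" for n
    using eps_qv_measurable[OF wd] pos T by auto
  have "tendsto_in_prob M ?W (\<lambda>_. 0) sequentially"
    using lim filterlim_compose[OF _ e] by (fastforce simp: tendsto_in_prob_def)
  then obtain r :: "nat \<Rightarrow> nat" where r: "strict_mono r"
      "AE \<omega> in M. (\<lambda>k. ?W (r k) \<omega>) \<longlonglongrightarrow> 0"
    using tendsto_in_prob_zero_AE_subseq[of ?W] by auto
  let ?N = "\<lambda>k \<omega>. \<integral>\<^sup>+s\<in>{0..T}.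
      ennreal (norm (tensor_square J (increment T X (e (r k)) s \<omega>)) / e (r k)) \<partial>lborel"
  have "AE \<omega> in M. ?N k \<omega> \<le> ennreal (eps_qv T X \<psi> (e (r k)) T \<omega>)" for k
  proof -
    have ek: "0 < e (r k)"
      using pos by simp
    show ?thesis
      using eps_qv_AE_set_integrable[OF wd ek]
    proof eventually_elim
      case (elim \<omega>)
      let ?x = "\<lambda>s. increment T X (e (r k)) s \<omega>"
      let ?q = "\<lambda>s. indicator {0..T} s *\<^sub>R (\<psi> (?x s) (?x s) / e (r k))"
      have \<psi>: "0 \<le> \<psi> x x" for x
        using order_trans[OF norm_ge_zero dom] .
      have int: "integrable lborel ?q"
        using elim T by (simp add: set_integrable_def)
      have "?N k \<omega> \<le> (\<integral>\<^sup>+s. ennreal (?q s) \<partial>lborel)"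
        using dom ek
        by (intro nn_integral_mono) (auto simp: indicator_def intro!: ennreal_leI divide_right_mono)
      also have "\<dots> = ennreal (eps_qv T X \<psi> (e (r k)) T \<omega>)"
        unfolding eps_qv_def set_lebesgue_integral_def
        using \<psi> ek by (intro nn_integral_eq_integral int) (auto simp: indicator_def)
      finally show ?case .
    qed
  qed
  then have "AE \<omega> in M. \<forall>k. ?N k \<omega> \<le> ennreal (eps_qv T X \<psi> (e (r k)) T \<omega>)"
    by (simp add: AE_all_countable)
  then have "AE \<omega> in M. (SUP k. ?N k \<omega>) < \<infinity>"
    using r(2)
  proof eventually_elim
    case (elim \<omega>)
    have "Bseq (\<lambda>k. ?W (r k) \<omega>)"
      using elim(2) by (intro convergent_imp_Bseq) (auto simp: convergent_def)
    then obtain C where C: "\<And>k. \<bar>?W (r k) \<omega>\<bar> \<le> C"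
      by (auto simp: Bseq_def)
    have "?N k \<omega> \<le> ennreal (Z \<omega> + C)" for k
    proof -
      have "eps_qv T X \<psi> (e (r k)) T \<omega> \<le> Z \<omega> + C"
        using C[of k] by linarith
      with elim(1) show ?thesis
        by (meson ennreal_leI order_trans)
    qed
    then have "(SUP k. ?N k \<omega>) \<le> ennreal (Z \<omega> + C)"
      by (rule SUP_least)
    also have "\<dots> < \<infinity>"
      by simp
    finally show ?case .
  qed
  with r(1) show "\<exists>r::nat \<Rightarrow> nat. strict_mono r \<and> (AE \<omega> in M. (SUP k. \<integral>\<^sup>+s\<in>{0..T}.
      ennreal (norm (tensor_square J (increment T X (e (r k)) s \<omega>)) / e (r k)) \<partial>lborel) < \<infinity>)"
    by (intro exI[of _ r] conjI)
qed

section \<open>Vector-valued combinations of real processes\<close>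

lemma bounded_variation_on_sum_scaleR:
  fixes v :: "'i \<Rightarrow> 'a::real_normed_vector"
  assumes mono: "\<And>i. i \<in> I \<Longrightarrow> mono_on {a..b} (f i)"
  shows "bounded_variation_on a b (\<lambda>t. \<Sum>i\<in>I. f i t *\<^sub>R v i)"
  unfolding bounded_variation_on_def
proof (intro exI allI impI, elim conjE)
  fix m :: nat and p :: "nat \<Rightarrow> real"
  assume p: "mono_on {..m} p" and sub: "p ` {..m} \<subseteq> {a..b}"
  have p_in: "p k \<in> {a..b}" if "k \<le> m" for k
    using sub that by auto
  have step: "f i (p k) \<le> f i (p (Suc k))" if "i \<in> I" "k < m" for i k
    using that p by (intro mono_onD[OF mono] p_in mono_onD[OF p]) auto
  have "(\<Sum>k<m. norm ((\<Sum>i\<in>I. f i (p (Suc k)) *\<^sub>R v i) - (\<Sum>i\<in>I. f i (p k) *\<^sub>R v i)))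
      \<le> (\<Sum>k<m. \<Sum>i\<in>I. (f i (p (Suc k)) - f i (p k)) * norm (v i))"
  proof (rule sum_mono)
    fix k
    assume k: "k \<in> {..<m}"
    have "(\<Sum>i\<in>I. f i (p (Suc k)) *\<^sub>R v i) - (\<Sum>i\<in>I. f i (p k) *\<^sub>R v i)
        = (\<Sum>i\<in>I. (f i (p (Suc k)) - f i (p k)) *\<^sub>R v i)"
      by (simp add: sum_subtractf scaleR_diff_left)
    also have "norm \<dots> \<le> (\<Sum>i\<in>I. norm ((f i (p (Suc k)) - f i (p k)) *\<^sub>R v i))"
      by (rule norm_sum)
    also have "\<dots> = (\<Sum>i\<in>I. (f i (p (Suc k)) - f i (p k)) * norm (v i))"
      using step k by (intro sum.cong) auto
    finally show "norm ((\<Sum>i\<in>I. f i (p (Suc k)) *\<^sub>R v i) - (\<Sum>i\<in>I. f i (p k) *\<^sub>R v i))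
        \<le> (\<Sum>i\<in>I. (f i (p (Suc k)) - f i (p k)) * norm (v i))" .
  qed
  also have "\<dots> = (\<Sum>i\<in>I. (\<Sum>k<m. f i (p (Suc k)) - f i (p k)) * norm (v i))"
    by (subst sum.swap) (simp add: sum_distrib_right)
  also have "\<dots> = (\<Sum>i\<in>I. (f i (p m) - f i (p 0)) * norm (v i))"
  proof -
    have "(\<Sum>k<m. f i (p (Suc k)) - f i (p k)) = f i (p m) - f i (p 0)" for i
      by (rule sum_lessThan_telescope)
    then show ?thesis
      by simp
  qed
  also have "\<dots> \<le> (\<Sum>i\<in>I. (f i b - f i a) * norm (v i))"
  proof (intro sum_mono mult_right_mono diff_mono)
    fix i
    assume "i \<in> I"
    from mono[OF this] show "f i (p m) \<le> f i b" "f i a \<le> f i (p 0)"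
      using p_in[of m] p_in[of 0] by (auto intro: mono_onD)
  qed simp
  finally show "(\<Sum>k<m. norm ((\<Sum>i\<in>I. f i (p (Suc k)) *\<^sub>R v i) - (\<Sum>i\<in>I. f i (p k) *\<^sub>R v i)))
      \<le> (\<Sum>i\<in>I. (f i b - f i a) * norm (v i))" .
qed

lemma cadlag_on_of_continuous_on:
  assumes "continuous_on {a..b} f"
  shows "cadlag_on a b f"
  unfolding cadlag_on_def
proof (intro conjI ballI)
  fix t
  assume t: "t \<in> {a..<b}"
  then have "(f \<longlongrightarrow> f t) (at t within {t..b})"
    using assms by (auto simp: continuous_on_def intro: tendsto_within_subset[of _ _ _ "{a..b}"])
  then show "(f \<longlongrightarrow> f t) (at_right t)"
    using t by (simp add: at_within_Icc_at_right)
next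
  fix t
  assume t: "t \<in> {a<..b}"
  then have "(f \<longlongrightarrow> f t) (at t within {a..t})"
    using assms by (auto simp: continuous_on_def intro: tendsto_within_subset[of _ _ _ "{a..b}"])
  then show "\<exists>l. (f \<longlongrightarrow> l) (at_left t)"
    using t by (auto simp: at_within_Icc_at_left)
qed

text \<open>The target space need not be second countable, so sums of measurable maps into it need not be
  measurable. The map is instead factored through coordinate space, from where it is continuous.\<close>

lemma measurable_process_sum_scaleR:
  fixes v :: "nat \<Rightarrow> 'a::real_normed_vector"
  assumes Z: "\<And>i. i \<in> I \<Longrightarrow> measurable_process M T (Z i)"
  shows "measurable_process M T (\<lambda>t \<omega>. \<Sum>i\<in>I. Z i t \<omega> *\<^sub>R v i)"
proof -
  let ?N = "M \<Otimes>\<^sub>M restrict_space borel {0..T}"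
  define g where "g x = (\<Sum>i\<in>I. x i *\<^sub>R v i)" for x :: "nat \<Rightarrow> real"
  define z where "z = (\<lambda>(\<omega>, t) i. if i \<in> I then Z i t \<omega> else 0)"
  have "z \<in> borel_measurable ?N"
  proof (rule measurable_coordinatewise_then_product)
    fix i
    show "(\<lambda>x. z x i) \<in> borel_measurable ?N"
      using Z[of i] by (cases "i \<in> I") (auto simp: z_def measurable_process_def case_prod_beta)
  qed
  moreover have "g \<in> borel_measurable borel"
    unfolding g_def by (intro borel_measurable_continuous_onI continuous_intros) auto
  ultimately have "(\<lambda>x. g (z x)) \<in> borel_measurable ?N"
    by (rule measurable_compose)
  then show ?thesis
    by (simp add: measurable_process_def g_def z_def case_prod_beta)
qed

lemma continuous_process_linear_combination:
  fixes Z :: "nat \<Rightarrow> real \<Rightarrow> 'w \<Rightarrow> real" and r :: "nat \<Rightarrow> real"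
  assumes fin: "finite I" and Z: "\<And>i. i \<in> I \<Longrightarrow> continuous_process M T (Z i)"
  shows "continuous_process M T (\<lambda>t \<omega>. \<Sum>i\<in>I. r i * Z i t \<omega>)"
  unfolding continuous_process_def
proof
  show "measurable_process M T (\<lambda>t \<omega>. \<Sum>i\<in>I. r i * Z i t \<omega>)"
    using measurable_process_sum_scaleR[of I M T Z r] Z
    by (simp add: continuous_process_def mult.commute)
  have "AE \<omega> in M. \<forall>i\<in>I. continuous_on {0..T} (\<lambda>t. Z i t \<omega>)"
    using Z by (intro AE_finite_allI fin) (auto simp: continuous_process_def)
  then show "AE \<omega> in M. continuous_on {0..T} (\<lambda>t. \<Sum>i\<in>I. r i * Z i t \<omega>)"
    by eventually_elim (auto intro!: continuous_intros)
qed

section \<open>The chi-quadratic variation of a finite-dimensional space of forms\<close>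

lemma chi_qv_imp_tendsto_in_prob:
  assumes M: "prob_space M" and qv: "has_chi_quadratic_variation M T J X"
    and forms: "\<And>i. i \<in> I \<Longrightarrow> \<phi> i \<in> range (blinfun_apply J)"
  shows "\<exists>Z. \<forall>i\<in>I. continuous_process M T (Z i) \<and>
    (\<forall>t\<in>{0..T}. tendsto_in_prob M (\<lambda>\<epsilon>. eps_qv T X (\<phi> i) \<epsilon> t) (Z i t) (at_right 0))"
proof -
  obtain Q where Q: "\<And>c. continuous_process M T (Q c)"
      "\<And>c. tendsto_ucp M T (eps_qv T X (J c)) (Q c) (at_right 0)"
    using qv unfolding has_chi_quadratic_variation_def chi_qv_H2_def by blast
  define c where "c i = inv (blinfun_apply J) (\<phi> i)" for i
  have c: "J (c i) = \<phi> i" if "i \<in> I" for i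
    unfolding c_def by (rule f_inv_into_f[OF forms[OF that]])
  have "continuous_process M T (Q (c i)) \<and>
      (\<forall>t\<in>{0..T}. tendsto_in_prob M (\<lambda>\<epsilon>. eps_qv T X (\<phi> i) \<epsilon> t) (Q (c i) t) (at_right 0))"
    if "i \<in> I" for i
    using Q(1) prob_space.tendsto_ucp_imp_tendsto_in_prob[OF M Q(2)[of "c i"], unfolded c[OF that]]
    by blast
  then show ?thesis
    by (intro exI[of _ "\<lambda>i. Q (c i)"] ballI)
qed

lemma chi_qv_of_tendsto_in_prob:
  fixes M :: "'w measure" and X :: "real \<Rightarrow> 'w \<Rightarrow> 'b::banach"
    and J :: "'c::banach \<Rightarrow>\<^sub>L 'b \<Rightarrow>\<^sub>L 'b \<Rightarrow>\<^sub>L real"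
    and \<phi> :: "nat \<Rightarrow> 'b \<Rightarrow>\<^sub>L 'b \<Rightarrow>\<^sub>L real" and a :: "nat \<Rightarrow> 'c \<Rightarrow>\<^sub>L real"
  assumes M: "prob_space M" and T: "0 \<le> T" and fin: "finite I"
    and J: "\<And>c. J c = (\<Sum>i\<in>I. a i c *\<^sub>R \<phi> i)"
    and pos: "\<And>i. i \<in> I \<Longrightarrow> positive_type (\<phi> i)"
    and wd: "\<And>\<psi>. \<psi> \<in> span (\<phi> ` I) \<Longrightarrow> eps_qv_well_defined M T X \<psi>"
    and Z: "\<And>i. i \<in> I \<Longrightarrow> continuous_process M T (Z i)"
    and lim: "\<And>i t. i \<in> I \<Longrightarrow> t \<in> {0..T} \<Longrightarrow>
      tendsto_in_prob M (\<lambda>\<epsilon>. eps_qv T X (\<phi> i) \<epsilon> t) (Z i t) (at_right 0)"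
  shows "has_chi_quadratic_variation M T J X"
proof -
  interpret prob_space M
    by (rule M)
  have wd_\<phi>: "eps_qv_well_defined M T X (\<phi> i)" if "i \<in> I" for i
    using that by (intro wd span_base) auto
  have pos_\<epsilon>: "\<forall>\<^sub>F \<epsilon>::real in at_right 0. 0 < \<epsilon>"
    by (rule eventually_at_right_less)
  have meas: "\<forall>\<^sub>F \<epsilon> in at_right 0. \<forall>t\<in>{0..T}. eps_qv T X (\<phi> i) \<epsilon> t \<in> borel_measurable M"
    if "i \<in> I" for i
    using pos_\<epsilon> by eventually_elim (intro ballI eps_qv_measurable wd_\<phi> that)
  have mono: "\<forall>\<^sub>F \<epsilon> in at_right 0. AE \<omega> in M. mono_on {0..T} (\<lambda>t. eps_qv T X (\<phi> i) \<epsilon> t \<omega>)"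
    if "i \<in> I" for i
    using pos_\<epsilon> by eventually_elim (intro eps_qv_AE_mono wd_\<phi> pos that)
  have ucp: "tendsto_ucp M T (eps_qv T X (\<phi> i)) (Z i) (at_right 0)" if "i \<in> I" for i
    by (rule tendsto_ucp_of_mono[OF trivial_limit_at_right_real T meas[OF that] mono[OF that]
          Z[OF that] lim[OF that]])
  have Z_mono: "AE \<omega> in M. mono_on {0..T} (\<lambda>t. Z i t \<omega>)" if "i \<in> I" for i
    by (rule AE_mono_on_of_tendsto_in_prob[OF trivial_limit_at_right_real meas[OF that] mono[OF that]
          Z[OF that] lim[OF that]])
  have ucp_comb: "tendsto_ucp M T (eps_qv T X (\<Sum>i\<in>I. r i *\<^sub>R \<phi> i))
      (\<lambda>t \<omega>. \<Sum>i\<in>I. r i * Z i t \<omega>) (at_right 0)" for r :: "nat \<Rightarrow> real"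
  proof (rule tendsto_ucp_linear_combination[OF fin ucp])
    show "\<forall>\<^sub>F \<epsilon> in at_right 0. AE \<omega> in M. \<forall>t\<in>{0..T}.
        eps_qv T X (\<Sum>i\<in>I. r i *\<^sub>R \<phi> i) \<epsilon> t \<omega> = (\<Sum>i\<in>I. r i * eps_qv T X (\<phi> i) \<epsilon> t \<omega>)"
      using pos_\<epsilon> by eventually_elim (intro eps_qv_AE_linear_combination fin wd_\<phi>)
  qed
  have cont_comb: "continuous_process M T (\<lambda>t \<omega>. \<Sum>i\<in>I. r i * Z i t \<omega>)" for r
    by (rule continuous_process_linear_combination[OF fin Z])
  have "chi_qv_H1 M T J X"
  proof (rule chi_qv_H1_of_dominating_form[OF T norm_tensor_square_le[OF J pos]])
    show "eps_qv_well_defined M T X (\<Sum>i\<in>I. norm (a i) *\<^sub>R \<phi> i)"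
      by (intro wd span_sum span_scale span_base imageI)
    show "(\<lambda>\<omega>. \<Sum>i\<in>I. norm (a i) * Z i T \<omega>) \<in> borel_measurable M"
      using cont_comb[of "\<lambda>i. norm (a i)"] T unfolding continuous_process_def
      by (intro measurable_process_at[where Y = "\<lambda>t \<omega>. \<Sum>i\<in>I. norm (a i) * Z i t \<omega>"]) auto
    show "tendsto_in_prob M (\<lambda>\<epsilon>. eps_qv T X (\<Sum>i\<in>I. norm (a i) *\<^sub>R \<phi> i) \<epsilon> T)
        (\<lambda>\<omega>. \<Sum>i\<in>I. norm (a i) * Z i T \<omega>) (at_right 0)"
      using tendsto_ucp_imp_tendsto_in_prob[OF ucp_comb, of T] T by simp
  qed
  moreover have "chi_qv_H2 M T J X"
    unfolding chi_qv_H2_def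
  proof (intro exI conjI allI ballI)
    fix c
    show "continuous_process M T (\<lambda>t \<omega>. \<Sum>i\<in>I. a i c * Z i t \<omega>)"
      by (rule cont_comb)
    show "tendsto_ucp M T (eps_qv T X (J c)) (\<lambda>t \<omega>. \<Sum>i\<in>I. a i c * Z i t \<omega>) (at_right 0)"
      unfolding J by (rule ucp_comb)
  next
    let ?V = "\<lambda>t \<omega>. \<Sum>i\<in>I. Z i t \<omega> *\<^sub>R a i"
    show "measurable_process M T ?V"
      using Z by (intro measurable_process_sum_scaleR) (auto simp: continuous_process_def)
    have "AE \<omega> in M. \<forall>i\<in>I. mono_on {0..T} (\<lambda>t. Z i t \<omega>)"
      by (intro AE_finite_allI fin Z_mono)
    moreover have "AE \<omega> in M. \<forall>i\<in>I. continuous_on {0..T} (\<lambda>t. Z i t \<omega>)"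
      using Z by (intro AE_finite_allI fin) (auto simp: continuous_process_def)
    ultimately show "AE \<omega> in M. cadlag_on 0 T (\<lambda>t. ?V t \<omega>) \<and> bounded_variation_on 0 T (\<lambda>t. ?V t \<omega>)"
    proof eventually_elim
      case (elim \<omega>)
      then show ?case
        by (intro conjI cadlag_on_of_continuous_on bounded_variation_on_sum_scaleR continuous_intros)
          auto
    qed
    show "AE \<omega> in M. ?V t \<omega> c = (\<Sum>i\<in>I. a i c * Z i t \<omega>)" for c t
      by (simp add: blinfun.sum_left blinfun.scaleR_left mult.commute)
  qed
  ultimately show ?thesis
    by (simp add: has_chi_quadratic_variation_def)
qed

theorem proposition3p27:
  fixes M :: "'w measure" and T :: real and n :: nat
    and \<phi> :: "nat \<Rightarrow> ('b::banach \<Rightarrow>\<^sub>L 'b \<Rightarrow>\<^sub>L real)"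
    and J :: "'c::banach \<Rightarrow>\<^sub>L 'b \<Rightarrow>\<^sub>L 'b \<Rightarrow>\<^sub>L real"
    and X :: "real \<Rightarrow> 'w \<Rightarrow> 'b"
  assumes "prob_space M" and "0 < T"
    and "inj_on \<phi> {1..n}" and "independent (\<phi> ` {1..n})"
    and "\<forall>i\<in>{1..n}. positive_type (\<phi> i)"
    and "inj (blinfun_apply J)" and "range (blinfun_apply J) = span (\<phi> ` {1..n})"
    and "measurable_process M T X"
    and "\<forall>\<psi>\<in>span (\<phi> ` {1..n}). eps_qv_well_defined M T X \<psi>"
  shows "has_chi_quadratic_variation M T J X \<longleftrightarrow>
    (\<exists>Z :: nat \<Rightarrow> real \<Rightarrow> 'w \<Rightarrow> real.
       \<forall>i\<in>{1..n}. continuous_process M T (Z i) \<and>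
         (\<forall>t\<in>{0..T}. tendsto_in_prob M (\<lambda>\<epsilon>. eps_qv T X (\<phi> i) \<epsilon> t) (Z i t) (at_right 0)))"
proof
  assume "has_chi_quadratic_variation M T J X"
  then show "\<exists>Z. \<forall>i\<in>{1..n}. continuous_process M T (Z i) \<and>
      (\<forall>t\<in>{0..T}. tendsto_in_prob M (\<lambda>\<epsilon>. eps_qv T X (\<phi> i) \<epsilon> t) (Z i t) (at_right 0))"
    by (rule chi_qv_imp_tendsto_in_prob[OF assms(1)]) (simp add: assms(7) span_base)
next
  assume "\<exists>Z. \<forall>i\<in>{1..n}. continuous_process M T (Z i) \<and>
      (\<forall>t\<in>{0..T}. tendsto_in_prob M (\<lambda>\<epsilon>. eps_qv T X (\<phi> i) \<epsilon> t) (Z i t) (at_right 0))"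
  then obtain Z where Z: "\<And>i. i \<in> {1..n} \<Longrightarrow> continuous_process M T (Z i)"
      "\<And>i t. i \<in> {1..n} \<Longrightarrow> t \<in> {0..T} \<Longrightarrow>
        tendsto_in_prob M (\<lambda>\<epsilon>. eps_qv T X (\<phi> i) \<epsilon> t) (Z i t) (at_right 0)"
    by blast
  obtain a :: "nat \<Rightarrow> 'c \<Rightarrow>\<^sub>L real" where a: "\<And>c. J c = (\<Sum>i\<in>{1..n}. a i c *\<^sub>R \<phi> i)"
    using exists_bounded_coordinates[OF finite_atLeastAtMost assms(3,4,6,7)] by blast
  show "has_chi_quadratic_variation M T J X"
  proof (rule chi_qv_of_tendsto_in_prob[OF assms(1) _ finite_atLeastAtMost a _ _ Z])
    show "0 \<le> T"
      using assms(2) by simp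
    show "positive_type (\<phi> i)" if "i \<in> {1..n}" for i
      using assms(5) that by blast
    show "eps_qv_well_defined M T X \<psi>" if "\<psi> \<in> span (\<phi> ` {1..n})" for \<psi>
      using assms(9) that by blast
  qed
qed

end
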